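(* Let $S_n$ denote the $n$-th Schröder number. For all integers $n\geq 1$ and $\alpha\geq 2$, $$S_{n+2^\alpha}\equiv S_{n}+(-1)^{\lfloor\frac{n-1}{2}\rfloor}2^{\alpha+1}\pmod{2^{\alpha+3}}.$$ Moreover, for $\alpha=1$, one has for all integers $n\ge 1$ $$S_{n+2}\equiv S_{n}+4\pmod{16}.$$
   Context: For an integer $n\ge 0$, the Schröder number $S_n$ is $$S_n=\sum_{k=0}^n\binom{n}{k}\binom{n+k}{k}\frac{1}{k+1}=\sum_{k=0}^n\binom{n+k}{2k}\binom{2k}{k}\frac{1}{k+1}.$$ It is a positive integer. For real $x$, $\lfloor x\rfloor=\max\{m\in\mathbb{Z}: m\leq x\}$. *)

theory Defs
  imports Complex_Main "HOL-Number_Theory.Cong"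
begin

(* The quotient is exact: see the lemma of_nat_schroeder. *)
definition schroeder :: "nat \<Rightarrow> nat" where
  "schroeder n = (\<Sum>k\<le>n. (n choose k) * ((n + k) choose k) div (k + 1))"

lemma choose_mult_choose_eq:
  assumes "k \<le> n"
  shows "(n choose k) * ((n + k) choose k) = ((n + k) choose (2 * k)) * ((2 * k) choose k)"
proof -
  have "((n + k) choose (2 * k)) * ((2 * k) choose k)
      = ((n + k) choose k) * ((n + k - k) choose (2 * k - k))"
    using assms by (intro choose_mult) auto
  then show ?thesis by (simp add: mult.commute)
qed

lemma Suc_dvd_central_binomial: "(k + 1) dvd ((2 * k) choose k)"
proof -
  have "(k + 1) * ((2 * k) choose (k + 1)) = k * ((2 * k) choose k)"
    using binomial_absorb_comp[of "2 * k" k] binomial_absorption[of k "2 * k"]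
    by (metis Suc_eq_plus1 add_diff_cancel_right' mult_2)
  then have "(k + 1) dvd k * ((2 * k) choose k)"
    by (metis dvd_triv_left)
  moreover have "coprime (k + 1) k"
    by simp
  ultimately show ?thesis
    by (simp add: coprime_dvd_mult_right_iff)
qed

lemma of_nat_schroeder:
  "(of_nat (schroeder n) :: real)
     = (\<Sum>k=0..n. of_nat (n choose k) * of_nat ((n + k) choose k) * (1 / of_nat (k + 1)))"
  unfolding schroeder_def of_nat_sum atLeast0AtMost
proof (rule sum.cong[OF refl])
  fix k assume "k \<in> {..n}"
  then have "(k + 1) dvd (n choose k) * ((n + k) choose k)"
    using Suc_dvd_central_binomial[of k] by (simp only: choose_mult_choose_eq atMost_iff) simp
  then show "(of_nat ((n choose k) * ((n + k) choose k) div (k + 1)) :: real)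
      = of_nat (n choose k) * of_nat ((n + k) choose k) * (1 / of_nat (k + 1))"
    by (simp add: real_of_nat_div del: of_nat_Suc of_nat_add)
qed

lemma of_nat_schroeder':
  "(of_nat (schroeder n) :: real)
     = (\<Sum>k=0..n. of_nat ((n + k) choose (2 * k)) * of_nat ((2 * k) choose k) * (1 / of_nat (k + 1)))"
  unfolding of_nat_schroeder
proof (rule sum.cong[OF refl])
  fix k assume "k \<in> {0..n}"
  then have "(of_nat (n choose k) * of_nat ((n + k) choose k) :: real)
      = of_nat ((n + k) choose (2 * k)) * of_nat ((2 * k) choose k)"
    by (metis atLeastAtMost_iff choose_mult_choose_eq of_nat_mult)
  then show "(of_nat (n choose k) * of_nat ((n + k) choose k) * (1 / of_nat (k + 1)) :: real)
      = of_nat ((n + k) choose (2 * k)) * of_nat ((2 * k) choose k) * (1 / of_nat (k + 1))"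
    by (rule arg_cong)
qed

end

theory Submission
  imports Defs "HOL-Computational_Algebra.Formal_Power_Series"
begin

text \<open>
  The defining sum of the Schroeder numbers hides their behaviour modulo powers of 2. A second
  formula shows it: with the Catalan numbers \<open>C\<^sub>j\<close>,
  \[ S_{m+1} = 2 \sum_j {m \choose 2j} 2^j C_j 3^{m-2j}, \]
  where \<open>2 ^ j\<close> makes the terms small in the 2-adic sense
  (\<open>schroeder_Suc_eq_sum\<close>). Both sums are coefficients of a Catalan series with a
  rational function substituted, so their generating functions satisfy quadratic equations. The
  affine substitution \<open>S = 1 + 2xM\<close> turns one equation into the other, and a quadratic of this
  form has only one power series solution.

  Let \<open>L\<close> be the linear functional on polynomials in \<open>y\<close> with \<open>L(y\<^sup>2\<^sup>j) = 2\<^sup>j C\<^sub>j\<close> that vanishes on odd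
  powers. Then \<open>S\<^sub>m\<^sub>+\<^sub>1 = 2 L((3 + y)\<^sup>m)\<close>, and for \<open>N = 2 ^ \<alpha>\<close> expanding one factor of
  \<open>(3 + y)\<^sup>m (3 + y)\<^sup>N\<close> gives
  \[ L((3+y)^{m+N}) = \sum_i {N \choose i} 3^{N-i} L(y^i (3+y)^m). \]
  Divided by 2, the claim says that this is \<open>L((3 + y)\<^sup>m) \<plusminus> N\<close> modulo \<open>4 N\<close>. The binomial
  coefficient loses at most the power of 2 in \<open>i\<close> against \<open>N\<close>, because
  \<open>i (N choose i) = N (N - 1 choose i - 1)\<close>, while \<open>L(y\<^sup>i (3 + y)\<^sup>m)\<close> is divisible by about \<open>2\<^sup>i\<^sup>/\<^sup>2\<close>.
  Hence every term with \<open>i \<notin> {0, 1, 2, 4}\<close> vanishes modulo \<open>4 N\<close>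
  (\<open>two_power_dvd_binomial_mult_shifted_moment\<close>). The term for \<open>i = 0\<close> is
  \<open>L((3 + y)\<^sup>m)\<close> modulo \<open>4 N\<close> because \<open>3\<^sup>N\<close> is 1. The terms for \<open>i = 1, 2, 4\<close> need
  \<open>L(y\<^sup>i (3 + y)\<^sup>m)\<close> only modulo 4, 8 and 16 respectively, and together they contribute
  \[ N (2m - (-1)^m + 2 + m(m-1)) , \]
  whose second factor is the required sign modulo 4. For \<open>N = 2\<close> the same expansion has three
  terms and is computed directly.
\<close>

section \<open>Catalan numbers and their generating function\<close>

unbundle fps_syntax

definition catalan :: "nat \<Rightarrow> nat" where
  "catalan k = ((2 * k) choose k) div (k + 1)"

lemma catalan_mult_Suc: "catalan k * (k + 1) = (2 * k) choose k"
  unfolding catalan_def using Suc_dvd_central_binomial[of k] by (rule dvd_div_mult_self)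

lemma schroeder_eq_sum_catalan:
  "schroeder n = (\<Sum>k\<le>n. ((n + k) choose (2 * k)) * catalan k)"
  unfolding schroeder_def
proof (rule sum.cong[OF refl])
  fix k assume "k \<in> {..n}"
  then show "(n choose k) * ((n + k) choose k) div (k + 1) = ((n + k) choose (2 * k)) * catalan k"
    by (simp only: choose_mult_choose_eq atMost_iff catalan_def
        div_mult_swap[OF Suc_dvd_central_binomial])
qed

lemma central_binomial_Suc:
  "(k + 1) * ((2 * Suc k) choose Suc k) = 2 * (2 * k + 1) * ((2 * k) choose k)"
proof -
  have "(2 * Suc k) choose Suc k = 2 * (Suc (2 * k) choose k)"
    using binomial_symmetric[of k "Suc (2 * k)"] by simp
  moreover have "(k + 1) * (Suc (2 * k) choose k) = (2 * k + 1) * ((2 * k) choose k)"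
    using binomial_absorb_comp[of "Suc (2 * k)" k] by simp
  ultimately show ?thesis by (metis mult.assoc mult.left_commute)
qed

definition catalan_fps :: "real fps" where
  "catalan_fps = Abs_fps (\<lambda>k. real (catalan k))"

lemma catalan_fps_nth [simp]: "catalan_fps $ k = real (catalan k)"
  by (simp add: catalan_fps_def)

text \<open>
  The series \<open>B\<close> of central binomial coefficients satisfies \<open>(1 - 4x) B' = 2 B\<close>, so
  \<open>(1 - 4x) B\<^sup>2\<close> is constant: \<open>B\<close> is an inverse square root of \<open>1 - 4x\<close>. Comparing coefficients,
  \<open>1 - 2x C = (1 - 4x) B\<close>, the square root itself, and squaring this is the quadratic equation.
\<close>

lemma catalan_fps_eq: "catalan_fps = 1 + fps_X * catalan_fps\<^sup>2"
proof -
  define B :: "real fps" where "B = Abs_fps (\<lambda>k. real ((2 * k) choose k))"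
  define Q :: "real fps" where "Q = 1 - 4 * fps_X"
  have B_nth: "B $ k = real ((2 * k) choose k)" for k
    by (simp add: B_def)
  have B_Suc: "(real k + 1) * B $ Suc k = (4 * real k + 2) * B $ k" for k
    using arg_cong[OF central_binomial_Suc[of k], of real] by (simp add: B_nth algebra_simps)
  have "Q * fps_deriv B = 2 * B"
  proof (rule fps_ext)
    fix k
    have "(Q * fps_deriv B) $ k = (real k + 1) * B $ Suc k - 4 * (real k * B $ k)"
      by (cases k) (simp_all add: Q_def left_diff_distrib mult.assoc fps_numeral_fps_const)
    also have "\<dots> = (2 * B) $ k"
      unfolding B_Suc by (simp add: fps_numeral_fps_const algebra_simps)
    finally show "(Q * fps_deriv B) $ k = (2 * B) $ k" .
  qed
  then have "fps_deriv (Q * B\<^sup>2) = 0"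
    by (simp add: Q_def power2_eq_square) algebra
  then have "Q * B\<^sup>2 = fps_const ((Q * B\<^sup>2) $ 0)"
    by (simp only: fps_deriv_eq_0_iff)
  then have QB: "Q * B\<^sup>2 = 1"
    by (simp add: Q_def B_nth fps_mult_nth_0 fps_power_zeroth)
  have "1 - 2 * (fps_X * catalan_fps) = Q * B"
  proof (rule fps_ext)
    fix k
    show "(1 - 2 * (fps_X * catalan_fps)) $ k = (Q * B) $ k"
    proof (cases k)
      case 0
      then show ?thesis by (simp add: Q_def B_nth)
    next
      case (Suc j)
      have *: "real (catalan j) * (real j + 1) = B $ j"
        using arg_cong[OF catalan_mult_Suc[of j], of real] by (simp add: B_nth algebra_simps)
      have "(real j + 1) * ((Q * B) $ k) = (real j + 1) * B $ Suc j - (real j + 1) * (4 * B $ j)"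
        by (simp add: Suc Q_def left_diff_distrib mult.assoc fps_numeral_fps_const right_diff_distrib)
      also have "\<dots> = - 2 * B $ j"
        unfolding B_Suc by (simp add: algebra_simps)
      also have "\<dots> = (real j + 1) * ((1 - 2 * (fps_X * catalan_fps)) $ k)"
        unfolding *[symmetric] by (simp add: Suc fps_numeral_fps_const)
      finally show ?thesis by simp
    qed
  qed
  then have "(1 - 2 * (fps_X * catalan_fps))\<^sup>2 = Q"
    using QB by algebra
  then have "(1 - 2 * (fps_X * catalan_fps))\<^sup>2 = 1 - 4 * fps_X"
    by (simp only: Q_def)
  then have "4 * fps_X * (catalan_fps - 1 - fps_X * catalan_fps\<^sup>2) = 0"
    by algebra
  then show ?thesis by (simp add: diff_eq_eq add.commute)
qed

section \<open>Substitution into the Catalan series\<close>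

text \<open>
  The series \<open>u C(b x\<^sup>r u\<^sup>2)\<close> with \<open>u = 1/(1 - a x)\<close>. It covers both sums at once: the parameters
  \<open>a = b = r = 1\<close> give the Schroeder numbers, and \<open>a = 3\<close>, \<open>b = r = 2\<close> the sum that is small
  2-adically.
\<close>

definition catalan_transform :: "real \<Rightarrow> real \<Rightarrow> nat \<Rightarrow> real fps" where
  "catalan_transform a b r =
     inverse (1 - fps_const a * fps_X) *
     (catalan_fps oo (fps_const b * fps_X ^ r * (inverse (1 - fps_const a * fps_X))\<^sup>2))"

text \<open>
  With \<open>v = b x\<^sup>r u\<^sup>2\<close>, the Catalan equation at \<open>v\<close> reads \<open>C(v) = 1 + b x\<^sup>r (u C(v))\<^sup>2\<close>, and
  \<open>C(v) = (1 - a x) (u C(v))\<close>.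
\<close>

lemma catalan_transform_eq:
  assumes "r > 0"
  shows "(1 - fps_const a * fps_X) * catalan_transform a b r
    = 1 + fps_const b * fps_X ^ r * (catalan_transform a b r)\<^sup>2"
proof -
  define u where "u = inverse (1 - fps_const a * fps_X)"
  define v where "v = fps_const b * fps_X ^ r * u\<^sup>2"
  have v0: "v $ 0 = 0" using assms by (simp add: v_def fps_mult_nth_0)
  have u: "(1 - fps_const a * fps_X) * u = 1"
    unfolding u_def by (rule inverse_mult_eq_1') simp
  have T: "catalan_transform a b r = u * (catalan_fps oo v)"
    by (simp add: catalan_transform_def u_def v_def)
  have "catalan_fps oo v = (1 + fps_X * catalan_fps\<^sup>2) oo v"
    using catalan_fps_eq by simp
  also have "\<dots> = 1 + v * (catalan_fps oo v)\<^sup>2"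
    using v0 by (simp add: fps_compose_add_distrib fps_compose_mult_distrib fps_compose_power)
  finally have "catalan_fps oo v = 1 + fps_const b * fps_X ^ r * (catalan_transform a b r)\<^sup>2"
    by (simp add: T v_def power_mult_distrib mult_ac)
  then show ?thesis by (simp add: T u flip: mult.assoc)
qed

text \<open>
  Since \<open>v\<^sup>k\<close> starts at \<open>x\<^sup>k\<close>, the composition may be cut off at \<open>n\<close> uniformly for all the
  coefficients that enter the product, so the two summations can be exchanged.
\<close>

lemma fps_mult_compose_nth:
  fixes u c v :: "'a :: comm_ring_1 fps"
  assumes "v $ 0 = 0"
  shows "(u * (c oo v)) $ n = (\<Sum>k\<le>n. c $ k * (u * v ^ k) $ n)"
proof -
  have "(c oo v) $ (n - i) = (\<Sum>k\<le>n. c $ k * (v ^ k) $ (n - i))" if "i \<le> n" for i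
    unfolding fps_compose_nth using assms that
    by (intro sum.mono_neutral_left) (auto simp: startsby_zero_power_prefix)
  then have "(u * (c oo v)) $ n = (\<Sum>i=0..n. \<Sum>k\<le>n. c $ k * (u $ i * (v ^ k) $ (n - i)))"
    unfolding fps_mult_nth by (intro sum.cong) (auto simp: sum_distrib_left mult_ac)
  also have "\<dots> = (\<Sum>k\<le>n. c $ k * (u * v ^ k) $ n)"
    by (subst sum.swap) (simp add: fps_mult_nth sum_distrib_left)
  finally show ?thesis .
qed

lemma catalan_transform_nth:
  assumes "r > 0"
  shows "catalan_transform a b r $ n
    = (\<Sum>k\<le>n. real (catalan k) * (if r * k \<le> n
         then b ^ k * real ((n - r * k + 2 * k) choose (2 * k)) * a ^ (n - r * k) else 0))"
proof -
  define u where "u = inverse (1 - fps_const a * fps_X)"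
  define v where "v = fps_const b * fps_X ^ r * u\<^sup>2"
  have v0: "v $ 0 = 0" using assms by (simp add: v_def fps_mult_nth_0)
  have u_pow: "u ^ Suc (2 * k) $ j = real ((j + 2 * k) choose (2 * k)) * a ^ j" for j k
    unfolding u_def fps_inverse_power[symmetric]
    by (subst one_minus_const_fps_X_neg_power')
       (use binomial_symmetric[of j "j + 2 * k"] in \<open>simp_all add: add.commute\<close>)
  have "u * v ^ k = fps_const (b ^ k) * (fps_X ^ (r * k) * u ^ Suc (2 * k))" for k
    unfolding v_def power_mult_distrib fps_const_power power_mult[symmetric]
    by (simp add: mult_ac)
  then have "(u * v ^ k) $ n = (if r * k \<le> n
      then b ^ k * real ((n - r * k + 2 * k) choose (2 * k)) * a ^ (n - r * k) else 0)" for k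
    by (simp add: fps_X_power_mult_nth u_pow del: power_Suc)
  then show ?thesis
    unfolding catalan_transform_def u_def[symmetric] v_def[symmetric]
    by (simp add: fps_mult_compose_nth[OF v0])
qed

section \<open>The second formula for the Schroeder numbers\<close>

text \<open>
  The difference of two solutions is annihilated by \<open>1 - x - x (S + T)\<close>, which is a unit. The
  other root of the quadratic equation has a pole at 0.
\<close>

lemma quadratic_fps_unique:
  fixes S T :: "real fps"
  assumes "(1 - fps_X) * S = 1 + fps_X * S\<^sup>2" and "(1 - fps_X) * T = 1 + fps_X * T\<^sup>2"
  shows "S = T"
proof -
  have "(S - T) * (1 - fps_X - fps_X * (S + T)) = 0"
    using assms by algebra
  moreover have "(1 - fps_X - fps_X * (S + T)) $ 0 \<noteq> 0" by simp
  then have "1 - fps_X - fps_X * (S + T) \<noteq> 0" by (metis fps_zero_nth)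
  ultimately show ?thesis by simp
qed

text \<open>
  The series \<open>M\<close> of the right-hand sums satisfies \<open>(1 - 3x) M = 1 + 2x\<^sup>2 M\<^sup>2\<close>. This is exactly what
  makes \<open>1 + 2x M\<close> a solution of the equation of the Schroeder series.
\<close>

lemma schroeder_Suc_eq_sum:
  "schroeder (Suc m) = 2 * (\<Sum>j\<le>m. (m choose (2 * j)) * 2 ^ j * catalan j * 3 ^ (m - 2 * j))"
proof -
  define M where "M = catalan_transform 3 2 2"
  define S where "S = catalan_transform 1 1 1"
  have S_nth: "S $ n = real (schroeder n)" for n
    unfolding S_def by (simp add: catalan_transform_nth schroeder_eq_sum_catalan)
       (intro sum.cong refl, simp add: ac_simps)
  have "(1 - fps_X) * S = 1 + fps_X * S\<^sup>2"
    using catalan_transform_eq[of 1 1 1] by (simp add: S_def)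
  moreover have "(1 - 3 * fps_X) * M = 1 + 2 * fps_X\<^sup>2 * M\<^sup>2"
    using catalan_transform_eq[of 2 3 2] by (simp add: M_def fps_numeral_fps_const)
  then have "(1 - fps_X) * (1 + 2 * fps_X * M) = 1 + fps_X * (1 + 2 * fps_X * M)\<^sup>2"
    by algebra
  ultimately have "S = 1 + 2 * fps_X * M"
    by (rule quadratic_fps_unique)
  then have "of_nat (schroeder (Suc m)) = (1 + 2 * (fps_X * M)) $ Suc m"
    by (simp only: S_nth[symmetric] mult.assoc)
  also have "\<dots> = 2 * M $ m"
    by (simp add: fps_numeral_fps_const)
  also have "M $ m = real (\<Sum>j\<le>m. (m choose (2 * j)) * 2 ^ j * catalan j * 3 ^ (m - 2 * j))"
    unfolding M_def of_nat_sum
    by (simp add: catalan_transform_nth) (intro sum.cong refl, simp add: mult_ac binomial_eq_0)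
  finally have "real (schroeder (Suc m))
      = real (2 * (\<Sum>j\<le>m. (m choose (2 * j)) * 2 ^ j * catalan j * 3 ^ (m - 2 * j)))"
    by (simp only: of_nat_mult of_nat_numeral)
  then show ?thesis by (simp only: of_nat_eq_iff)
qed


section \<open>The moment functional\<close>

text \<open>The value \<open>L(y\<^sup>r)\<close> of the functional from the introduction.\<close>

definition moment :: "nat \<Rightarrow> int" where
  "moment r = (if even r then 2 ^ (r div 2) * int (catalan (r div 2)) else 0)"

text \<open>
  The value \<open>L(y\<^sup>r (3 + y)\<^sup>m)\<close>. Recursion on the exponent of \<open>3 + y\<close> replaces a double sum, lets
  congruences be proved by induction on \<open>m\<close>, and avoids negative powers of 3.
\<close>

primrec shifted_moment :: "nat \<Rightarrow> nat \<Rightarrow> int" where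
  "shifted_moment 0 r = moment r"
| "shifted_moment (Suc m) r = 3 * shifted_moment m r + shifted_moment m (Suc r)"

text \<open>
  The image under \<open>L\<close> of \<open>y\<^sup>r (3 + y)\<^sup>m (3 + y)\<^sup>N\<close> with the last factor expanded. The induction is the
  one of the binomial theorem.
\<close>

lemma shifted_moment_add:
  "shifted_moment (m + N) r
    = (\<Sum>i\<le>N. int (N choose i) * 3 ^ (N - i) * shifted_moment m (r + i))"
proof (induction N arbitrary: r)
  case 0
  then show ?case by simp
next
  case (Suc N)
  let ?g = "\<lambda>i. shifted_moment m (r + i)"
  have "(\<Sum>i\<le>Suc N. int (Suc N choose i) * 3 ^ (Suc N - i) * ?g i)
      = 3 ^ Suc N * ?g 0 + (\<Sum>i\<le>N. int (N choose Suc i) * 3 ^ (N - i) * ?g (Suc i))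
        + (\<Sum>i\<le>N. int (N choose i) * 3 ^ (N - i) * ?g (Suc i))"
    by (subst sum.atMost_Suc_shift) (simp add: algebra_simps sum.distrib)
  also have "3 ^ Suc N * ?g 0 + (\<Sum>i\<le>N. int (N choose Suc i) * 3 ^ (N - i) * ?g (Suc i))
      = (\<Sum>i\<le>Suc N. int (N choose i) * 3 ^ (Suc N - i) * ?g i)"
    by (subst sum.atMost_Suc_shift) simp
  also have "\<dots> = 3 * (\<Sum>i\<le>N. int (N choose i) * 3 ^ (N - i) * ?g i)"
    by (simp add: sum_distrib_left Suc_diff_le mult_ac)
  finally show ?case
    using Suc.IH[of r] Suc.IH[of "Suc r"] by simp
qed

lemma schroeder_Suc_eq_shifted_moment: "int (schroeder (Suc m)) = 2 * shifted_moment m 0"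
proof -
  let ?h = "\<lambda>i. int (m choose i) * 3 ^ (m - i) * moment i"
  have "shifted_moment m 0 = (\<Sum>i\<le>m. ?h i)"
    using shifted_moment_add[of 0 m 0] by simp
  also have "\<dots> = (\<Sum>i\<in>(*) 2 ` {..m}. ?h i)"
  proof (rule sum.mono_neutral_cong)
    show "?h i = 0" if "i \<in> (*) 2 ` {..m} - {..m}" for i
      using that by (simp add: binomial_eq_0)
    show "?h i = 0" if "i \<in> {..m} - (*) 2 ` {..m}" for i
      using that by (auto simp: moment_def elim!: evenE)
  qed auto
  also have "\<dots> = (\<Sum>j\<le>m. ?h (2 * j))"
    by (subst sum.reindex) (auto simp: inj_on_def)
  finally show ?thesis
    unfolding schroeder_Suc_eq_sum by (simp add: moment_def mult_ac)
qed

section \<open>Divisibility of moments\<close>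

lemma catalan_small:
  "catalan 0 = 1" "catalan 1 = 1" "catalan 2 = 2" "catalan 3 = 5" "catalan 4 = 14"
proof -
  have "(2 choose 1) = (2 :: nat)" "(4 choose 2) = (6 :: nat)" "(6 choose 3) = (20 :: nat)"
    "(8 choose 4) = (70 :: nat)"
    using central_binomial_Suc[of 0] central_binomial_Suc[of 1] central_binomial_Suc[of 2]
      central_binomial_Suc[of 3] by (simp_all add: numeral_2_eq_2[symmetric] del: binomial_Suc_Suc)
  then show "catalan 0 = 1" "catalan 1 = 1" "catalan 2 = 2" "catalan 3 = 5" "catalan 4 = 14"
    using catalan_mult_Suc[of 1] by (simp_all add: catalan_def)
qed

lemma moment_small:
  "moment 0 = 1" "moment (Suc 0) = 0" "moment 2 = 2" "moment 4 = 8" "moment 5 = 0" "moment 6 = 40"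
  "moment 8 = 224"
  using catalan_small by (simp_all add: moment_def)

lemma dvd_shifted_moment:
  assumes "\<And>k. k \<ge> r \<Longrightarrow> d dvd moment k"
  shows "d dvd shifted_moment m r"
  using assms by (induction m arbitrary: r) auto

lemma two_power_dvd_moment: "2 ^ ((k + 1) div 2) dvd moment k"
  by (auto simp: moment_def elim!: evenE)

lemma two_power_dvd_shifted_moment:
  assumes "2 * e \<le> r + 1"
  shows "2 ^ e dvd shifted_moment m r"
proof (rule dvd_shifted_moment)
  fix k assume "r \<le> k"
  then have "(2 :: int) ^ e dvd 2 ^ ((k + 1) div 2)"
    using assms by (intro le_imp_power_dvd) auto
  then show "2 ^ e dvd moment k"
    using two_power_dvd_moment dvd_trans by blast
qed

text \<open>
  For \<open>r = 3\<close> and \<open>r = 8\<close> the general bound can be improved by one factor of 2. The gain at 8 comes from the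
  even Catalan number \<open>C\<^sub>4 = 14\<close>, and the one at 3 from the vanishing of the third moment.
\<close>

lemma dvd_shifted_moment_8: "32 dvd shifted_moment m 8"
proof (rule dvd_shifted_moment)
  fix k :: nat assume "8 \<le> k"
  then consider "k = 8" | "k = 9" | "10 \<le> k" by linarith
  then show "32 dvd moment k"
  proof cases
    case 3
    then have "(2 :: int) ^ 5 dvd 2 ^ ((k + 1) div 2)"
      by (intro le_imp_power_dvd) auto
    then show ?thesis
      using two_power_dvd_moment[of k] dvd_trans by fastforce
  qed (simp_all add: moment_small, simp add: moment_def)
qed

lemma dvd_shifted_moment_3: "8 dvd shifted_moment m 3"
proof (rule dvd_shifted_moment)
  fix k :: nat assume "3 \<le> k"
  then consider "k = 3" | "k = 4" | "5 \<le> k" by linarith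
  then show "8 dvd moment k"
  proof cases
    case 3
    then have "(2 :: int) ^ 3 dvd 2 ^ ((k + 1) div 2)"
      by (intro le_imp_power_dvd) auto
    then show ?thesis
      using two_power_dvd_moment[of k] dvd_trans by fastforce
  qed (simp_all add: moment_small, simp add: moment_def)
qed

section \<open>Residues of the low moments\<close>

lemma cong_int_obtain:
  fixes x y k :: int
  assumes "[x = y] (mod k)"
  obtains t where "x = y + k * t"
  using assms unfolding cong_iff_dvd_diff by (metis add.commute diff_add_cancel dvdE)

text \<open>Used to drop powers of 3 and odd binomial coefficients in front of even factors.\<close>

lemma odd_mult_even_cong:
  fixes x y :: int
  assumes "odd x" "even y"
  shows "[y * x = y] (mod 4)"
proof -
  obtain s t where "x = 2 * s + 1" "y = 2 * t"
    using assms by (auto elim!: oddE evenE)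
  then have "y * x - y = 4 * (s * t)" by (simp add: algebra_simps)
  then show ?thesis by (simp add: cong_iff_dvd_diff)
qed

lemma shifted_moment_2_cong: "[shifted_moment m 2 = 2 * 3 ^ m] (mod 8)"
proof (induction m)
  case (Suc m)
  have "8 dvd shifted_moment m (Suc 2)"
    using dvd_shifted_moment_3[of m] by (simp add: numeral_3_eq_3)
  then have "[3 * shifted_moment m 2 + shifted_moment m (Suc 2) = 3 * (2 * 3 ^ m) + 0] (mod 8)"
    using Suc by (intro cong_add cong_mult) (auto simp: cong_0_iff)
  then show ?case by (simp add: mult.left_commute)
qed (simp add: moment_small)

lemma shifted_moment_1_cong: "[shifted_moment m 1 = 2 * int m] (mod 4)"
proof (induction m)
  case (Suc m)
  have "[2 * (3 :: int) ^ m = 2] (mod 4)"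
    by (rule odd_mult_even_cong) auto
  moreover have "[shifted_moment m 2 = 2 * 3 ^ m] (mod 4)"
    using shifted_moment_2_cong by (rule cong_dvd_modulus) simp
  ultimately have "[shifted_moment m 2 = 2] (mod 4)" using cong_trans by blast
  with Suc show ?case
    by (simp add: cong_iff_dvd_diff numeral_2_eq_2[symmetric] Suc_1) presburger
qed (simp add: moment_small)

text \<open>
  The recursion expresses a moment for \<open>m + 1\<close> by those of the same and of the next index for \<open>m\<close>.
  So the residue at 4 needs the ones at 5 and 6, and the chain ends at 7, where the
  divisibility bound already gives 0 modulo 16.
\<close>

lemma shifted_moment_6_cong: "[shifted_moment m 6 = 8] (mod 16)"
proof (induction m)
  case (Suc m)
  have "[shifted_moment m 7 = 0] (mod 16)"
    using two_power_dvd_shifted_moment[of 4 7 m] by (simp add: cong_0_iff)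
  then have "[3 * shifted_moment m 6 + shifted_moment m 7 = 3 * 8 + 0] (mod 16)"
    using Suc by (intro cong_add cong_scalar_left)
  also have "[3 * 8 + 0 = (8 :: int)] (mod 16)" by (simp add: cong_def)
  finally show ?case by simp
qed (simp add: moment_small cong_def)

lemma shifted_moment_5_cong: "[shifted_moment m 5 = 8 * int m] (mod 16)"
proof (induction m)
  case (Suc m)
  then have "[3 * shifted_moment m 5 + shifted_moment m 6 = 3 * (8 * int m) + 8] (mod 16)"
    by (intro cong_add cong_scalar_left shifted_moment_6_cong)
  also have "[3 * (8 * int m) + 8 = 8 * int (Suc m)] (mod 16)"
    by (simp add: cong_iff_dvd_diff)
  finally show ?case by simp
qed (simp add: moment_small)

lemma shifted_moment_4_cong: "[shifted_moment m 4 = 8 + 4 * (int m * (int m - 1))] (mod 16)"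
proof (induction m)
  case (Suc m)
  have "even (int m * (int m - 1))" by simp
  then obtain t where t: "int m * (int m - 1) = 2 * t" by blast
  have t': "int (Suc m) * (int (Suc m) - 1) = 2 * t + 2 * int m"
    unfolding t[symmetric] by (simp add: algebra_simps)
  have "[3 * shifted_moment m 4 + shifted_moment m 5 = 3 * (8 + 4 * (2 * t)) + 8 * int m] (mod 16)"
    using Suc unfolding t by (intro cong_add cong_scalar_left shifted_moment_5_cong)
  also have "3 * (8 + 4 * (2 * t)) + 8 * int m - (8 + 4 * (2 * t + 2 * int m)) = 16 * (1 + t)"
    by simp
  then have "[3 * (8 + 4 * (2 * t)) + 8 * int m = 8 + 4 * (2 * t + 2 * int m)] (mod 16)"
    unfolding cong_iff_dvd_diff by (metis dvd_triv_left)
  finally show ?case unfolding t' by simp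
qed (simp add: moment_small)

section \<open>Terms that vanish\<close>

lemma binomial_two_power_absorb:
  assumes "i > 0"
  shows "int i * int (2 ^ \<alpha> choose i) = 2 ^ \<alpha> * int ((2 ^ \<alpha> - 1) choose (i - 1))"
proof -
  have "i * (2 ^ \<alpha> choose i) = 2 ^ \<alpha> * ((2 ^ \<alpha> - 1) choose (i - 1))"
    using binomial_absorption[of "i - 1" "2 ^ \<alpha>"] assms by simp
  from arg_cong[OF this, of int] show ?thesis by simp
qed

lemma two_power_ge: "4 \<le> v \<Longrightarrow> 2 * (v + 2) \<le> 2 ^ v" for v :: nat
  by (induction v rule: dec_induct) auto

text \<open>
  The general bound gives the exponent \<open>(i + 1) div 2\<close>, while \<open>2 ^ v \<le> i\<close> keeps \<open>v\<close> logarithmic in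
  \<open>i\<close>. This settles all but small indices: 8 is covered by the stronger bound there, and
  1, 2 and 4 have to be excluded.
\<close>

lemma four_mult_two_power_dvd_shifted_moment:
  assumes "2 ^ v dvd i" "i > 0" "i \<noteq> 1" "i \<noteq> 2" "i \<noteq> 4"
  shows "2 ^ (v + 2) dvd shifted_moment m i"
proof (cases "i = 8")
  case True
  then have "v \<le> 3"
    using assms(1) power_dvd_imp_le[of 2 v 3] by simp
  then have "(2 :: int) ^ (v + 2) dvd 2 ^ 5"
    by (intro le_imp_power_dvd) simp
  then show ?thesis
    using dvd_shifted_moment_8[of m] True dvd_trans by fastforce
next
  case False
  have "2 ^ v \<le> i" using assms by (intro dvd_imp_le)
  have "2 * (v + 2) \<le> i + 1"
  proof -
    consider "v = 0" | "v = 1" | "v = 2" | "v = 3" | "4 \<le> v" by linarith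
    then show ?thesis
    proof cases
      case 1
      then show ?thesis using assms by simp
    next
      case 2
      then have "2 dvd i" using assms by simp
      then show ?thesis using assms(2,4,5) 2 by presburger
    next
      case 3
      then have "4 dvd i" using assms by simp
      then show ?thesis using assms(2,5) False 3 by presburger
    next
      case 4
      then have "8 dvd i" using assms by simp
      then show ?thesis using assms(2) False 4 by presburger
    next
      case 5
      then show ?thesis using two_power_ge[of v] \<open>2 ^ v \<le> i\<close> by simp
    qed
  qed
  then show ?thesis by (rule two_power_dvd_shifted_moment)
qed

text \<open>
  Write \<open>i = 2 ^ v q\<close> with \<open>q\<close> odd. The moment supplies the factor \<open>4 \<cdot> 2 ^ v\<close>; after multiplication by
  \<open>q\<close> this becomes \<open>4 i\<close>, and \<open>i (2 ^ \<alpha> choose i)\<close> is divisible by \<open>2 ^ \<alpha>\<close>. The odd factor \<open>q\<close> can be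
  cancelled again.
\<close>

lemma two_power_dvd_binomial_mult_shifted_moment:
  assumes "i > 0" "i \<noteq> 1" "i \<noteq> 2" "i \<noteq> 4"
  shows "2 ^ (\<alpha> + 2) dvd int (2 ^ \<alpha> choose i) * shifted_moment m i"
proof -
  obtain v q where i: "i = 2 ^ v * q" and "odd q"
    by (rule multiplicity_decompose'[of i 2]) (use assms(1) in auto)
  obtain w where w: "shifted_moment m i = 2 ^ (v + 2) * w"
    using four_mult_two_power_dvd_shifted_moment[of v i m] assms i by auto
  have "int q * (int (2 ^ \<alpha> choose i) * shifted_moment m i)
      = 4 * w * (int i * int (2 ^ \<alpha> choose i))"
    by (subst w) (simp add: i power_add)
  also have "\<dots> = 2 ^ (\<alpha> + 2) * (w * int ((2 ^ \<alpha> - 1) choose (i - 1)))"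
    using assms(1) by (simp add: binomial_two_power_absorb power_add)
  finally have "2 ^ (\<alpha> + 2) dvd int q * (int (2 ^ \<alpha> choose i) * shifted_moment m i)"
    by simp
  moreover have "coprime ((2 :: int) ^ (\<alpha> + 2)) (int q)"
    using \<open>odd q\<close> by (intro coprime_power_left_iff[THEN iffD2] disjI1) simp
  ultimately show ?thesis by (simp add: coprime_dvd_mult_right_iff del: power_add)
qed

section \<open>The increments of the second formula\<close>

text \<open>Each squaring of \<open>1 + 2 ^ k t\<close> with \<open>k \<ge> 1\<close> gains a factor of 2, starting at \<open>9 = 1 + 8\<close>.\<close>

lemma three_power_two_power_cong: "\<alpha> \<ge> 1 \<Longrightarrow> [3 ^ 2 ^ \<alpha> = (1 :: int)] (mod 2 ^ (\<alpha> + 2))"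
proof (induction \<alpha> rule: dec_induct)
  case base
  then show ?case by (simp add: cong_def)
next
  case (step a)
  then obtain t where "(3 :: int) ^ 2 ^ a - 1 = 2 ^ (a + 2) * t"
    by (auto simp: cong_iff_dvd_diff)
  then have "(3 :: int) ^ 2 ^ a = 1 + 2 * (2 ^ (a + 1) * t)" by simp
  then have "(3 :: int) ^ 2 ^ Suc a = (1 + 2 * (2 ^ (a + 1) * t))\<^sup>2"
    by (simp only: power_Suc2 power_mult)
  also have "\<dots> = 1 + 2 ^ (Suc a + 2) * (t * (1 + 2 ^ (a + 1) * t))"
    by (simp add: power2_eq_square algebra_simps)
  finally show ?case
    unfolding cong_iff_dvd_diff by (simp only: add_diff_cancel_left' dvd_triv_left)
qed

text \<open>
  For \<open>N = 4 p + 4\<close> this is the cofactor of \<open>N\<close> in \<open>4 (N choose 4) = N (N - 1 choose 3)\<close>.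
\<close>

lemma odd_binomial_3: "odd ((4 * p + 3) choose 3)"
proof -
  have "2 * ((4 * p + 2) choose 2) = 2 * ((2 * p + 1) * (4 * p + 1))"
    using binomial_absorption[of 1 "4 * p + 2"]
    by (simp only: Suc_1 choose_one) (simp add: algebra_simps)
  then have "(4 * p + 2) choose 2 = (2 * p + 1) * (4 * p + 1)"
    by (simp only: mult_cancel1) simp
  moreover have "4 * p + 3 - 1 = 4 * p + 2" "Suc 2 = 3" by simp_all
  ultimately have "3 * ((4 * p + 3) choose 3) = (4 * p + 3) * ((2 * p + 1) * (4 * p + 1))"
    using binomial_absorption[of 2 "4 * p + 3"] by metis
  then have "odd (3 * ((4 * p + 3) choose 3))" by simp
  then show ?thesis by simp
qed

text \<open>
  The left-hand side collects the contributions of \<open>i = 1\<close>, \<open>i = 2\<close> and \<open>i = 4\<close>, divided by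
  \<open>N\<close>. Modulo 4 it depends only on \<open>m mod 4\<close>.
\<close>

lemma sign_cong:
  "[2 * int m - (- 1) ^ m + (2 + int m * (int m - 1)) = (- 1) ^ (m div 2)] (mod 4)"
proof -
  define q where "q = m div 4"
  have "m = 4 * q + m mod 4" by (simp add: q_def)
  moreover have "m mod 4 = 0 \<or> m mod 4 = 1 \<or> m mod 4 = 2 \<or> m mod 4 = 3" by auto
  ultimately consider "m = 4 * q" | "m = 4 * q + 1" | "m = 4 * q + 2" | "m = 4 * q + 3"
    by linarith
  then show ?thesis
  proof cases
    case 1
    have "m div 2 = 2 * q" using 1 by simp
    then show ?thesis
      by (simp add: 1 cong_iff_dvd_diff algebra_simps)
  next
    case 2
    have "m div 2 = 2 * q" using 2 by simp
    then show ?thesis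
      by (simp add: 2 cong_iff_dvd_diff algebra_simps)
  next
    case 3
    have "m div 2 = 2 * q + 1" using 3 by simp
    then show ?thesis
      by (simp add: 3 cong_iff_dvd_diff algebra_simps)
  next
    case 4
    have "m div 2 = 2 * q + 1" using 4 by simp
    then show ?thesis
      by (simp add: 4 cong_iff_dvd_diff algebra_simps)
  qed
qed

lemma three_power_cong: "[3 ^ k = (- 1 :: int) ^ k] (mod 4)"
  by (rule cong_pow) (simp add: cong_def)

text \<open>
  In the expansion with \<open>N = 2 ^ \<alpha>\<close> only \<open>i = 0, 1, 2, 4\<close> survive modulo \<open>4 N\<close>. In each of the last
  three, the binomial coefficient and the moment together provide a factor \<open>N\<close>, so that
  the cofactor matters only modulo 4. The assumption \<open>\<alpha> \<ge> 2\<close> ensures that \<open>i = 4\<close> occurs and that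
  \<open>N - 1\<close> is \<open>-1\<close> modulo 4.
\<close>

lemma shifted_moment_add_two_power_cong:
  assumes "\<alpha> \<ge> 2"
  shows "[shifted_moment (m + 2 ^ \<alpha>) 0
    = shifted_moment m 0 + 2 ^ \<alpha> * (- 1) ^ (m div 2)] (mod 2 ^ (\<alpha> + 2))"
proof -
  define N :: nat where "N = 2 ^ \<alpha>"
  have modulus: "(2 :: int) ^ (\<alpha> + 2) = int N * 4" by (simp add: N_def power_add)
  have "2 ^ 2 dvd N" unfolding N_def using assms by (rule le_imp_power_dvd)
  then obtain c where c: "N = 4 * c" by auto
  have "c > 0" using c N_def by (cases c) auto
  then obtain p where p: "N = 4 * p + 4"
    using c by (cases c) auto
  let ?F = "shifted_moment m"
  define T where "T i = int (N choose i) * 3 ^ (N - i) * ?F i" for i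
  have absorb: "int i * int (N choose i) = int N * int ((N - 1) choose (i - 1))" if "i > 0" for i
    using binomial_two_power_absorb[OF that, of \<alpha>] by (simp add: N_def)
  have "shifted_moment (m + N) 0 - sum T {0, 1, 2, 4} = sum T ({..N} - {0, 1, 2, 4})"
    using shifted_moment_add[of m N 0] p by (subst sum_diff) (auto simp: T_def)
  also have "int N * 4 dvd \<dots>"
  proof (rule dvd_sum)
    fix i assume "i \<in> {..N} - {0, 1, 2, 4}"
    then have "int N * 4 dvd int (N choose i) * ?F i"
      using two_power_dvd_binomial_mult_shifted_moment[of i \<alpha> m] modulus by (simp add: N_def mult.commute)
    then have "int N * 4 dvd (int (N choose i) * ?F i) * 3 ^ (N - i)" by (rule dvd_mult2)
    then show "int N * 4 dvd T i" by (simp add: T_def mult_ac)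
  qed
  finally have "[shifted_moment (m + N) 0 = sum T {0, 1, 2, 4}] (mod int N * 4)"
    by (simp add: cong_iff_dvd_diff)
  then have main: "[shifted_moment (m + N) 0 = T 0 + T 1 + T 2 + T 4] (mod int N * 4)"
    by (simp add: add.assoc)
  have T0: "[T 0 = ?F 0] (mod int N * 4)"
    using cong_scalar_right[OF three_power_two_power_cong[of \<alpha>], of "?F 0"] assms modulus
    by (simp add: T_def N_def mult.commute)
  have T1: "[T 1 = int N * (2 * int m)] (mod int N * 4)"
  proof -
    have "[?F 1 * 3 ^ (N - 1) = 2 * int m * 3 ^ (N - 1)] (mod 4)"
      by (rule cong_scalar_right) (rule shifted_moment_1_cong)
    also have "[2 * int m * 3 ^ (N - 1) = 2 * int m] (mod 4)"
      by (rule odd_mult_even_cong) auto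
    finally have "[int N * (?F 1 * 3 ^ (N - 1)) = int N * (2 * int m)] (mod int N * 4)"
      by (rule cong_cmult_leftI)
    then show ?thesis by (simp add: T_def mult_ac)
  qed
  \<comment> \<open>\<open>2 (N choose 2) = N (N - 1)\<close>, so the even second moment restores the missing factor 2\<close>
  have T2: "[T 2 = int N * - ((- 1) ^ m)] (mod int N * 4)"
  proof -
    obtain t where "?F 2 = 2 * 3 ^ m + 8 * t"
      using shifted_moment_2_cong[of m] by (rule cong_int_obtain)
    then have t: "?F 2 = 2 * (3 ^ m + 4 * t)" by simp
    have "[3 ^ (N - 2) * (int (N - 1) * (3 ^ m + 4 * t)) = (- 1) ^ (N - 2) * (- 1 * ((- 1) ^ m))] (mod 4)"
    proof (intro cong_mult three_power_cong)
      show "[int (N - 1) = - 1] (mod 4)" using p by (simp add: cong_iff_dvd_diff)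
      show "[3 ^ m + 4 * t = (- 1) ^ m] (mod 4)"
        using cong_add[OF three_power_cong[of m], of "4 * t" 0] by (simp add: cong_0_iff)
    qed
    also have "(- 1) ^ (N - 2) * (- 1 * ((- 1) ^ m)) = - ((- 1 :: int) ^ m)"
      using p by simp
    finally have "[int N * (3 ^ (N - 2) * (int (N - 1) * (3 ^ m + 4 * t))) = int N * - ((- 1) ^ m)] (mod int N * 4)"
      by (rule cong_cmult_leftI)
    moreover have "T 2 = (2 * int (N choose 2)) * (3 ^ (N - 2) * (3 ^ m + 4 * t))"
      by (simp add: T_def t)
    then have "T 2 = int N * (3 ^ (N - 2) * (int (N - 1) * (3 ^ m + 4 * t)))"
      using absorb[of 2] by simp
    ultimately show ?thesis by simp
  qed
  \<comment> \<open>\<open>4 (N choose 4) = N (N - 1 choose 3)\<close>, and the fourth moment is divisible by 4\<close>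
  have T4: "[T 4 = int N * (2 + int m * (int m - 1))] (mod int N * 4)"
  proof -
    let ?b = "int ((N - 1) choose 3)" and ?e = "2 + int m * (int m - 1)"
    obtain t where "?F 4 = 8 + 4 * (int m * (int m - 1)) + 16 * t"
      using shifted_moment_4_cong[of m] by (rule cong_int_obtain)
    then have t: "?F 4 = 4 * (?e + 4 * t)" by simp
    have "[(?e + 4 * t) * (3 ^ (N - 4) * ?b) = ?e + 4 * t] (mod 4)"
      using odd_binomial_3[of p] p by (intro odd_mult_even_cong) (auto simp: add.commute)
    also have "[?e + 4 * t = ?e] (mod 4)" by (simp add: cong_iff_dvd_diff)
    finally have "[int N * ((?e + 4 * t) * (3 ^ (N - 4) * ?b)) = int N * ?e] (mod int N * 4)"
      by (rule cong_cmult_leftI)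
    moreover have "T 4 = (4 * int (N choose 4)) * ((?e + 4 * t) * 3 ^ (N - 4))"
      by (simp add: T_def t)
    then have "T 4 = int N * ((?e + 4 * t) * (3 ^ (N - 4) * ?b))"
      using absorb[of 4] by simp
    ultimately show ?thesis by simp
  qed
  have "[shifted_moment (m + N) 0 = ?F 0 + int N * (2 * int m) + int N * - ((- 1) ^ m)
      + int N * (2 + int m * (int m - 1))] (mod int N * 4)"
    using main cong_add[OF cong_add[OF cong_add[OF T0 T1] T2] T4] by (rule cong_trans)
  also have "?F 0 + int N * (2 * int m) + int N * - ((- 1) ^ m) + int N * (2 + int m * (int m - 1))
      = ?F 0 + int N * (2 * int m - (- 1) ^ m + (2 + int m * (int m - 1)))"
    by (simp add: algebra_simps)
  also have "[\<dots> = ?F 0 + int N * (- 1) ^ (m div 2)] (mod int N * 4)"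
    by (intro cong_add cong_refl cong_cmult_leftI sign_cong)
  finally show ?thesis unfolding modulus by (simp add: N_def)
qed

text \<open>
  Here \<open>(3 + y)\<^sup>2 = 9 + 6 y + y\<^sup>2\<close>, and the residues of the first two moments give
  the increment \<open>4 m + 2 (-1)\<^sup>m\<close> modulo 8, which is 2 for either parity of \<open>m\<close>.
\<close>

lemma shifted_moment_add_2_cong:
  "[shifted_moment (m + 2) 0 = shifted_moment m 0 + 2] (mod 8)"
proof -
  let ?F = "shifted_moment m"
  obtain t where t: "?F 1 = 2 * int m + 4 * t"
    using shifted_moment_1_cong[of m] by (rule cong_int_obtain)
  obtain u where u: "?F 2 = 2 * 3 ^ m + 8 * u"
    using shifted_moment_2_cong[of m] by (rule cong_int_obtain)
  obtain w where w: "(3 :: int) ^ m = (- 1) ^ m + 4 * w"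
    using three_power_cong[of m] by (rule cong_int_obtain)
  have "shifted_moment (m + 2) 0 = 9 * ?F 0 + 6 * ?F 1 + ?F 2"
    by (simp add: numeral_2_eq_2)
  then have "shifted_moment (m + 2) 0 - (?F 0 + 2)
      = 8 * (?F 0 + int m + 3 * t + u + w) + (4 * int m + 2 * (- 1) ^ m - 2)"
    unfolding t u w by (simp add: algebra_simps)
  moreover have "8 dvd 4 * int m + 2 * (- 1) ^ m - 2"
    by (cases "even m") (auto elim!: evenE oddE)
  ultimately show ?thesis
    by (simp only: cong_iff_dvd_diff dvd_add dvd_triv_left)
qed

theorem theorem0p2:
  "(\<forall>n \<alpha> :: nat. n \<ge> 1 \<longrightarrow> \<alpha> \<ge> 2 \<longrightarrow>
      [int (schroeder (n + 2 ^ \<alpha>))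
        = int (schroeder n) + (- 1) ^ ((n - 1) div 2) * 2 ^ (\<alpha> + 1)] (mod (2 ^ (\<alpha> + 3))))
   \<and> (\<forall>n :: nat. n \<ge> 1 \<longrightarrow>
      [int (schroeder (n + 2)) = int (schroeder n) + 4] (mod 16))"
proof (intro conjI allI impI)
  fix n \<alpha> :: nat
  assume "n \<ge> 1" "\<alpha> \<ge> 2"
  then obtain m where n: "n = Suc m" by (cases n) auto
  have "[2 * shifted_moment (m + 2 ^ \<alpha>) 0
      = 2 * (shifted_moment m 0 + 2 ^ \<alpha> * (- 1) ^ (m div 2))] (mod 2 * 2 ^ (\<alpha> + 2))"
    by (intro cong_cmult_leftI shifted_moment_add_two_power_cong \<open>\<alpha> \<ge> 2\<close>)
  then show "[int (schroeder (n + 2 ^ \<alpha>))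
      = int (schroeder n) + (- 1) ^ ((n - 1) div 2) * 2 ^ (\<alpha> + 1)] (mod 2 ^ (\<alpha> + 3))"
    by (simp add: n schroeder_Suc_eq_shifted_moment power_add algebra_simps)
next
  fix n :: nat
  assume "n \<ge> 1"
  then obtain m where n: "n = Suc m" by (cases n) auto
  have "[2 * shifted_moment (m + 2) 0 = 2 * (shifted_moment m 0 + 2)] (mod 2 * 8)"
    by (intro cong_cmult_leftI shifted_moment_add_2_cong)
  moreover have "schroeder (n + 2) = schroeder (Suc (m + 2))" by (simp add: n)
  ultimately show "[int (schroeder (n + 2)) = int (schroeder n) + 4] (mod 16)"
    by (simp only: n schroeder_Suc_eq_shifted_moment) simp
qed

end
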